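(* Let $\mathcal X\subset\{0,1\}^d$ and assume that $A(x)\ne0$ for all $x\in\mathcal X$. The risk-adjustable distributionally robust chance-constrained problem with left-hand side uncertainty $$\min_{x\in\mathcal X,\ \alpha\in[0,\bar\alpha]}\Big\{c^\top x+g(\alpha):\ \inf_{f\in\mathcal D}\mathbb P_f\big(A(x)\xi\ge b(x)\big)\ge1-\alpha\Big\}$$ is equivalent to the following mixed integer conic formulation, where $M_0$ and $M_n^2$, $n=1,\dots,N$, are sufficiently large (big-M) constants: $$\begin{aligned}\min_{x\in\mathcal X,\,\pi,\,z,\,\beta,\,t,\,\alpha}\quad & c^\top x+g(\alpha)\\ \text{s.t.}\quad & \epsilon N\|A(\pi)\|_*+\sum_{n=1}^N\beta_n\le\alpha N,\\ & A(\pi)\xi^n-(qt-\bar b^\top\pi)+z_nM_n^2+\beta_n\ge1,\quad n=1,\dots,N,\\ & (1-z_n)M_n^2+\beta_n\ge1,\quad n=1,\dots,N,\\ & t\ge0,\ \beta_n\ge0,\ z_n\in\{0,1\},\quad n=1,\dots,N,\\ & \pi_k\ge t+(x_k-1)M_0,\ \pi_k\le x_kM_0,\ \pi_k\le t,\ \pi_k\ge0,\quad k=1,\dots,d,\\ & \alpha\in(0,\bar\alpha].\end{aligned}$$ Furthermore, $\sum_{n=1}^Nz_n\le\alpha N$ is a valid inequality for this formulation.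
   Context: Data: $c\in\mathbb R^d$, $\bar\alpha\in(0,1)$, a monotonically increasing function $g:[0,\bar\alpha]\to[0,\infty)$, $\bar A\in\mathbb R^{l\times d}$, $\bar b\in\mathbb R^d$, $q\in\mathbb R$. The random vector $\xi\in\mathbb R^l$ enters the constraint $T(\xi)x\ge q$ with $T(\xi)=\xi^\top\bar A+\bar b^\top$; this constraint is written as $A(x)\xi\ge b(x)$, where $A(x)=x^\top\bar A^\top$ (a $1\times l$ row vector, linear in $x$; the same formula defines $A(\pi)$ for $\pi\in\mathbb R^d$) and $b(x)=q-\bar b^\top x$. Given samples $\xi^1,\dots,\xi^N\in\mathbb R^l$ and a radius $\epsilon>0$, $\mathcal D$ is the Wasserstein ball of all probability distributions $f$ on $\mathbb R^l$ with $W(\mathbb P_f,\mathbb P_0)\le\epsilon$, where $\mathbb P_0$ is the empirical distribution (mass $1/N$ on each sample) and $W(\mathbb P_1,\mathbb P_2)=\inf_{\mathbb Q}\mathbb E_{\mathbb Q}\|\tilde\xi_1-\tilde\xi_2\|$ over joint distributions $\mathbb Q$ with marginals $\mathbb P_1,\mathbb P_2$. Here $\|\cdot\|$ is the norm ($p$-norm) on $\mathbb R^l$ and $\|\cdot\|_*$ is its dual norm. "Equivalent" means that $(x,\alpha)$ is feasible for the first problem if and only if it extends to a feasible solution of the formulation (with the same objective value). $M_0$ serves as an upper bound on the variable $t$, and $M_n^2$ is large enough (given $M_0$) that the constraint it relaxes becomes redundant. *)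

theory Defs
  imports "HOL-Probability.Probability"
begin

definition pnorm :: "ereal \<Rightarrow> real ^ 'n \<Rightarrow> real" where
  "pnorm p v =
     (if p = \<infinity> then infnorm v
      else (\<Sum>i\<in>UNIV. \<bar>v $ i\<bar> powr real_of_ereal p) powr (1 / real_of_ereal p))"

definition dual_norm :: "(real ^ 'n \<Rightarrow> real) \<Rightarrow> real ^ 'n \<Rightarrow> real" where
  "dual_norm nrm v = (SUP u\<in>{u. nrm u \<le> 1}. v \<bullet> u)"

definition couplings :: "(real ^ 'l) measure \<Rightarrow> (real ^ 'l) measure \<Rightarrow> ((real ^ 'l) \<times> (real ^ 'l)) measure set" where
  "couplings P1 P2 =
     {Q. prob_space Q \<and> sets Q = sets (borel \<Otimes>\<^sub>M borel) \<and> distr Q borel fst = P1 \<and> distr Q borel snd = P2}"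

text \<open>Extended-nonnegative-valued: a distribution without a first moment is at distance \<open>\<infinity>\<close> from any empirical one.\<close>

definition wasserstein :: "(real ^ 'l \<Rightarrow> real) \<Rightarrow> (real ^ 'l) measure \<Rightarrow> (real ^ 'l) measure \<Rightarrow> ennreal" where
  "wasserstein nrm P1 P2 =
     (INF Q\<in>couplings P1 P2. \<integral>\<^sup>+ w. ennreal (nrm (fst w - snd w)) \<partial>Q)"

text \<open>The index type \<open>'n\<close> has \<open>N = CARD('n)\<close> elements; samples that coincide accumulate their mass.\<close>

definition empirical :: "real ^ 'l ^ 'n \<Rightarrow> (real ^ 'l) measure" where
  "empirical \<xi> = distr (uniform_count_measure (UNIV :: 'n set)) borel (\<lambda>n. \<xi> $ n)"

definition wasserstein_ball ::
    "(real ^ 'l \<Rightarrow> real) \<Rightarrow> real ^ 'l ^ 'n \<Rightarrow> real \<Rightarrow> (real ^ 'l) measure set" where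
  "wasserstein_ball nrm \<xi> \<epsilon> =
     {f. prob_space f \<and> sets f = sets borel \<and> wasserstein nrm f (empirical \<xi>) \<le> ennreal \<epsilon>}"

definition A_of :: "real ^ 'd ^ 'l \<Rightarrow> real ^ 'd \<Rightarrow> real ^ 'l" where
  "A_of Abar x = x v* transpose Abar"

definition b_of :: "real \<Rightarrow> real ^ 'd \<Rightarrow> real ^ 'd \<Rightarrow> real" where
  "b_of q bbar x = q - bbar \<bullet> x"

definition drcc_feasible ::
    "(real ^ 'l \<Rightarrow> real) \<Rightarrow> (real ^ 'd) set \<Rightarrow> real \<Rightarrow> real ^ 'd ^ 'l \<Rightarrow> real ^ 'd \<Rightarrow> real \<Rightarrow>
     real ^ 'l ^ 'n \<Rightarrow> real \<Rightarrow> ((real ^ 'd) \<times> real) set" where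
  "drcc_feasible nrm X \<alpha>bar Abar bbar q \<xi> \<epsilon> =
     {(x, \<alpha>). x \<in> X \<and> \<alpha> \<in> {0..\<alpha>bar} \<and>
        (INF f\<in>wasserstein_ball nrm \<xi> \<epsilon>. measure f {\<zeta>. A_of Abar x \<bullet> \<zeta> \<ge> b_of q bbar x}) \<ge> 1 - \<alpha>}"

definition drcc_objective :: "real ^ 'd \<Rightarrow> (real \<Rightarrow> real) \<Rightarrow> (real ^ 'd) \<times> real \<Rightarrow> real" where
  "drcc_objective c g = (\<lambda>(x, \<alpha>). c \<bullet> x + g \<alpha>)"

text \<open>Points of the formulation are tuples \<open>(x, \<pi>, z, \<beta>, t, \<alpha>)\<close>.\<close>

type_synonym ('d, 'n) mic_point =
  "(real ^ 'd) \<times> (real ^ 'd) \<times> (real ^ 'n) \<times> (real ^ 'n) \<times> real \<times> real"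

definition mic_feasible ::
    "(real ^ 'l \<Rightarrow> real) \<Rightarrow> (real ^ 'd) set \<Rightarrow> real \<Rightarrow> real ^ 'd ^ 'l \<Rightarrow> real ^ 'd \<Rightarrow> real \<Rightarrow>
     real ^ 'l ^ 'n \<Rightarrow> real \<Rightarrow> real \<Rightarrow> real ^ 'n \<Rightarrow> ('d, 'n) mic_point set" where
  "mic_feasible nrm X \<alpha>bar Abar bbar q \<xi> \<epsilon> M0 M2 =
     {(x, \<pi>, z, \<beta>, t, \<alpha>).
        x \<in> X \<and>
        \<epsilon> * real CARD('n) * dual_norm nrm (A_of Abar \<pi>) + (\<Sum>n\<in>UNIV. \<beta> $ n) \<le> \<alpha> * real CARD('n) \<and>
        (\<forall>n. A_of Abar \<pi> \<bullet> \<xi> $ n - (q * t - bbar \<bullet> \<pi>) + z $ n * M2 $ n + \<beta> $ n \<ge> 1) \<and>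
        (\<forall>n. (1 - z $ n) * M2 $ n + \<beta> $ n \<ge> 1) \<and>
        t \<ge> 0 \<and> (\<forall>n. \<beta> $ n \<ge> 0) \<and> (\<forall>n. z $ n \<in> {0, 1}) \<and>
        (\<forall>k. \<pi> $ k \<ge> t + (x $ k - 1) * M0 \<and> \<pi> $ k \<le> x $ k * M0 \<and> \<pi> $ k \<le> t \<and> \<pi> $ k \<ge> 0) \<and>
        \<alpha> \<in> {0<..\<alpha>bar}}"

definition mic_objective :: "real ^ 'd \<Rightarrow> (real \<Rightarrow> real) \<Rightarrow> ('d, 'n) mic_point \<Rightarrow> real" where
  "mic_objective c g = (\<lambda>(x, \<pi>, z, \<beta>, t, \<alpha>). c \<bullet> x + g \<alpha>)"

definition mic_proj :: "('d, 'n) mic_point \<Rightarrow> (real ^ 'd) \<times> real" where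
  "mic_proj = (\<lambda>(x, \<pi>, z, \<beta>, t, \<alpha>). (x, \<alpha>))"

text \<open>A problem \<open>(F, obj)\<close> is equivalent to an extended formulation \<open>(G, obj')\<close> under the projection
  \<open>proj\<close> onto the original variables.\<close>

definition equivalent_formulation ::
    "('b \<Rightarrow> 'a) \<Rightarrow> 'a set \<Rightarrow> ('a \<Rightarrow> real) \<Rightarrow> 'b set \<Rightarrow> ('b \<Rightarrow> real) \<Rightarrow> bool" where
  "equivalent_formulation proj F obj G obj' \<longleftrightarrow>
     (\<forall>u. u \<in> F \<longleftrightarrow> (\<exists>v\<in>G. proj v = u)) \<and> (\<forall>v\<in>G. obj' v = obj (proj v))"

end

theory Submission
  imports Defs
begin

text \<open>Fix \<open>x\<close> and write \<open>a = A(x)\<close>, \<open>b = b(x)\<close>. The half-space \<open>{\<zeta>. a \<bullet> \<zeta> < b}\<close> of violating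
  scenarios lies at distance \<open>d\<^sub>n = max 0 (a \<bullet> \<xi>\<^sub>n - b) / \<parallel>a\<parallel>\<^sub>*\<close> from the sample \<open>\<xi>\<^sub>n\<close>. An adversary
  with transport budget \<open>\<epsilon>\<close> who wants to maximize the violation probability picks the fraction
  \<open>\<theta>\<^sub>n \<in> [0, 1]\<close> of the atom at \<open>\<xi>\<^sub>n\<close> to push across the boundary, at unit cost \<open>d\<^sub>n\<close>. This is a
  fractional knapsack problem with capacity \<open>\<epsilon> N\<close>, whose linear programming dual is
  \<open>min\<^bsub>\<mu> \<ge> 0\<^esub> \<mu> \<epsilon> N + (\<Sum>n. max 0 (1 - \<mu> d\<^sub>n))\<close>. The chance constraint therefore holds iff some
  multiplier \<open>\<mu>\<close> has dual value at most \<open>\<alpha> N\<close>, which is \<open>worst_case_chance_dual\<close>.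

  Its two halves avoid general duality theory. Given a multiplier, \<open>violation_le_dual_value\<close>
  integrates the pointwise bound \<open>1[a \<bullet> \<eta> < b] \<le> \<mu> \<parallel>\<eta> - \<zeta>\<parallel> + max 0 (1 - \<mu> d(\<zeta>))\<close> over a coupling of the
  two distributions. Conversely \<open>knapsack_duality\<close> exhibits a multiplier together with a
  feasible \<open>\<theta>\<close> of at least the same value, and \<open>violation_ge_knapsack_value\<close> realizes \<open>\<theta>\<close> by a
  distribution in the ball. The violating half-space is open, so the distance \<open>d\<^sub>n\<close> is not attained; one
  moves slightly smaller fractions slightly too far and passes to the limit.

  The mixed integer formulation is this condition rewritten. Put \<open>t = \<mu> / \<parallel>a\<parallel>\<^sub>*\<close>. Then
  \<open>\<mu> d\<^sub>n = t max 0 (a \<bullet> \<xi>\<^sub>n - b)\<close>, so the norm disappears from the hinge terms. The bilinear product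
  \<open>\<pi> = t x\<close> is linearized exactly because \<open>x\<close> is binary, \<open>\<parallel>A(\<pi>)\<parallel>\<^sub>* = t \<parallel>a\<parallel>\<^sub>* = \<mu>\<close>, and \<open>z\<^sub>n\<close> selects which
  of the bounds \<open>\<beta>\<^sub>n \<ge> 1 - t (a \<bullet> \<xi>\<^sub>n - b)\<close> and \<open>\<beta>\<^sub>n \<ge> 1\<close> is imposed. The big-M constants exist because the budget row
  forces \<open>t \<le> 1 / (\<epsilon> \<parallel>A(x)\<parallel>\<^sub>*)\<close> and only finitely many \<open>x\<close> occur. The same row excludes \<open>\<alpha> = 0\<close>:
  either \<open>t > 0\<close>, and the norm term is positive, or \<open>t = 0\<close>, and all \<open>\<beta>\<^sub>n\<close> are at least 1.\<close>

section \<open>The dual norm and the distance to a half-space\<close>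

text \<open>The properties of the \<open>p\<close>-norms, common to all \<open>p\<close>, on which the duality argument rests. Dominating every
  coordinate makes the unit ball bounded, so that the supremum in \<^const>\<open>dual_norm\<close> is a
  genuine one.\<close>

locale gauge =
  fixes nrm :: "real ^ 'l \<Rightarrow> real"
  assumes scale: "nrm (s *\<^sub>R u) = \<bar>s\<bar> * nrm u"
    and component_le: "\<bar>u $ i\<bar> \<le> nrm u"
    and borel_measurable_nrm [measurable]: "nrm \<in> borel_measurable borel"
begin

lemma nrm_nonneg: "0 \<le> nrm u"
  using component_le[of u undefined] by linarith

lemma nrm_zero [simp]: "nrm 0 = 0"
  using scale[of 0 0] by simp

lemma nrm_pos: "u \<noteq> 0 \<Longrightarrow> 0 < nrm u"
  using component_le[of u] by (metis less_le_trans vec_eq_iff zero_index zero_less_abs_iff)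

lemma norm_le_nrm: "norm u \<le> real CARD('l) * nrm u"
proof -
  have "norm u \<le> (\<Sum>i\<in>UNIV. \<bar>u $ i\<bar>)"
    by (rule norm_le_l1_cart)
  also have "\<dots> \<le> (\<Sum>i\<in>(UNIV :: 'l set). nrm u)"
    by (intro sum_mono component_le)
  finally show ?thesis by simp
qed

lemma unit_ball_nonempty: "{u. nrm u \<le> 1} \<noteq> {}"
  using nrm_zero by (metis empty_iff mem_Collect_eq zero_le_one)

lemma bdd_above_dual: "bdd_above ((\<lambda>u. a \<bullet> u) ` {u. nrm u \<le> 1})"
proof (rule bdd_aboveI2)
  fix u assume "u \<in> {u. nrm u \<le> 1}"
  then have "real CARD('l) * nrm u \<le> real CARD('l)"
    by (simp add: mult_left_le)
  with norm_le_nrm[of u] have "norm u \<le> real CARD('l)"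
    by linarith
  moreover have "a \<bullet> u \<le> norm a * norm u"
    by (rule norm_cauchy_schwarz)
  ultimately show "a \<bullet> u \<le> norm a * real CARD('l)"
    by (meson mult_left_mono norm_ge_zero order_trans)
qed

lemma inner_le_dual_unit: "nrm u \<le> 1 \<Longrightarrow> a \<bullet> u \<le> dual_norm nrm a"
  unfolding dual_norm_def by (rule cSUP_upper[OF _ bdd_above_dual]) simp

lemma dual_nonneg: "0 \<le> dual_norm nrm a"
  using inner_le_dual_unit[of 0 a] by simp

text \<open>Hoelder's inequality, obtained by normalizing \<open>u\<close>.\<close>

lemma inner_le_dual: "a \<bullet> u \<le> dual_norm nrm a * nrm u"
proof (cases "u = 0")
  case False
  then have "0 < nrm u" by (rule nrm_pos)
  with inner_le_dual_unit[of "(1 / nrm u) *\<^sub>R u" a] show ?thesis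
    by (simp add: scale field_simps)
qed simp

lemma dual_pos:
  assumes "a \<noteq> 0"
  shows "0 < dual_norm nrm a"
proof -
  have "0 < a \<bullet> a" using assms by simp
  also have "\<dots> \<le> dual_norm nrm a * nrm a" by (rule inner_le_dual)
  finally show ?thesis using nrm_pos[OF assms] by (simp add: zero_less_mult_iff)
qed

text \<open>A near-maximizer of the dual norm suffices below: it is the direction in which mass is pushed
  out of the safe half-space.\<close>

lemma dual_approx:
  assumes "r < dual_norm nrm a"
  obtains u where "nrm u \<le> 1" "r < a \<bullet> u"
proof -
  from assms that show ?thesis
    unfolding dual_norm_def less_cSUP_iff[OF unit_ball_nonempty bdd_above_dual] by blast
qed

lemma dual_scale:
  assumes "0 \<le> t"
  shows "dual_norm nrm (t *\<^sub>R a) = t * dual_norm nrm a"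
proof (cases "t = 0")
  case True
  have "dual_norm nrm 0 = (SUP u\<in>{u. nrm u \<le> 1}. (0::real))"
    by (simp add: dual_norm_def)
  also have "\<dots> = 0"
    by (rule cSUP_const[OF unit_ball_nonempty])
  finally show ?thesis using True by simp
next
  case False
  with assms have t: "0 < t" by simp
  show ?thesis
  proof (rule antisym)
    show "dual_norm nrm (t *\<^sub>R a) \<le> t * dual_norm nrm a"
      unfolding dual_norm_def[of _ "t *\<^sub>R a"]
      using unit_ball_nonempty t by (intro cSUP_least) (auto intro: inner_le_dual_unit)
    have "dual_norm nrm a \<le> dual_norm nrm (t *\<^sub>R a) / t"
      unfolding dual_norm_def[of _ a]
    proof (rule cSUP_least[OF unit_ball_nonempty])
      fix u assume "u \<in> {u. nrm u \<le> 1}"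
      with inner_le_dual_unit[of u "t *\<^sub>R a"] t
      show "a \<bullet> u \<le> dual_norm nrm (t *\<^sub>R a) / t" by (simp add: field_simps)
    qed
    with t show "t * dual_norm nrm a \<le> dual_norm nrm (t *\<^sub>R a)"
      by (simp add: field_simps)
  qed
qed

text \<open>The distance from \<open>\<zeta>\<close> to the open half-space \<open>{\<eta>. a \<bullet> \<eta> < b}\<close> when \<open>a \<noteq> 0\<close>: the next lemmas show that no
  violating point is closer, and that violating points exist within every larger distance.\<close>

definition gap :: "real ^ 'l \<Rightarrow> real \<Rightarrow> real ^ 'l \<Rightarrow> real" where
  "gap a b \<zeta> = max 0 (a \<bullet> \<zeta> - b) / dual_norm nrm a"

lemma gap_nonneg: "0 \<le> gap a b \<zeta>"
  by (simp add: gap_def dual_nonneg)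

text \<open>Hoelder's inequality for \<open>\<zeta> - \<eta>\<close>, whose inner product with \<open>a\<close> exceeds \<open>a \<bullet> \<zeta> - b\<close>.\<close>

lemma gap_le_distance:
  assumes "a \<noteq> 0" "a \<bullet> \<eta> < b"
  shows "gap a b \<zeta> \<le> nrm (\<eta> - \<zeta>)"
proof -
  have D: "0 < dual_norm nrm a" using assms(1) by (rule dual_pos)
  have "a \<bullet> \<zeta> - b \<le> a \<bullet> (-1) *\<^sub>R (\<eta> - \<zeta>)"
    using assms(2) by (simp add: inner_diff_right)
  also have "\<dots> \<le> dual_norm nrm a * nrm (\<eta> - \<zeta>)"
    using inner_le_dual[of a "(-1) *\<^sub>R (\<eta> - \<zeta>)"] scale[of "-1" "\<eta> - \<zeta>"] by simp
  finally have "max 0 (a \<bullet> \<zeta> - b) \<le> dual_norm nrm a * nrm (\<eta> - \<zeta>)"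
    using D nrm_nonneg[of "\<eta> - \<zeta>"] by simp
  then show ?thesis using D by (simp add: gap_def field_simps)
qed

text \<open>Step from \<open>\<zeta>\<close> by \<open>s\<close> against a direction in which \<open>a\<close> nearly attains its dual norm.\<close>

lemma violation_near:
  assumes "a \<noteq> 0" "gap a b \<zeta> < s"
  obtains \<eta> where "a \<bullet> \<eta> < b" "nrm (\<eta> - \<zeta>) \<le> s"
proof -
  have D: "0 < dual_norm nrm a" using assms(1) by (rule dual_pos)
  have s: "0 < s" using assms(2) gap_nonneg[of a b \<zeta>] by linarith
  have "max 0 (a \<bullet> \<zeta> - b) < s * dual_norm nrm a"
    using assms(2) D by (simp add: gap_def field_simps)
  then have "(a \<bullet> \<zeta> - b) / s < dual_norm nrm a"
    using s by (simp add: field_simps)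
  then obtain u where u: "nrm u \<le> 1" "(a \<bullet> \<zeta> - b) / s < a \<bullet> u"
    by (rule dual_approx)
  show ?thesis
  proof
    show "a \<bullet> (\<zeta> - s *\<^sub>R u) < b"
      using u(2) s by (simp add: inner_diff_right field_simps)
    show "nrm (\<zeta> - s *\<^sub>R u - \<zeta>) \<le> s"
      using scale[of "-s" u] u(1) s by (simp add: mult_left_le)
  qed
qed

end

section \<open>Integration against the empirical distribution\<close>

text \<open>Via this description, sums over samples and two-stage random experiments can be treated with the calculus of
  probability mass functions.\<close>

lemma empirical_eq_pmf:
  "empirical \<xi> = distr (measure_pmf (pmf_of_set (UNIV :: 'n::finite set))) borel (\<lambda>n. \<xi> $ n)"
proof -
  have "uniform_count_measure (UNIV :: 'n set) = measure_pmf (pmf_of_set UNIV)"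
    by (rule measure_eqI)
       (simp_all add: emeasure_uniform_count_measure emeasure_pmf_of_set sets_uniform_count_measure)
  then show ?thesis by (simp add: empirical_def)
qed

lemma nn_integral_empirical:
  fixes \<xi> :: "real ^ 'l ^ 'n"
  assumes [measurable]: "h \<in> borel_measurable borel" and nn: "\<And>\<zeta>. 0 \<le> h \<zeta>"
  shows "(\<integral>\<^sup>+ \<zeta>. ennreal (h \<zeta>) \<partial>empirical \<xi>) = ennreal ((\<Sum>n\<in>UNIV. h (\<xi> $ n)) / real CARD('n))"
proof -
  have "(\<integral>\<^sup>+ \<zeta>. ennreal (h \<zeta>) \<partial>empirical \<xi>)
      = (\<integral>\<^sup>+ n. ennreal (h (\<xi> $ n)) \<partial>measure_pmf (pmf_of_set (UNIV :: 'n set)))"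
    unfolding empirical_eq_pmf by (rule nn_integral_distr) auto
  also have "\<dots> = ennreal ((\<Sum>n\<in>UNIV. h (\<xi> $ n)) / real CARD('n))"
    by (simp add: nn_integral_pmf_of_set nn sum_ennreal divide_ennreal sum_nonneg flip: ennreal_of_nat_eq_real_of_nat
       ) (simp add: ennreal_of_nat_eq_real_of_nat divide_ennreal sum_nonneg nn)
  finally show ?thesis .
qed

section \<open>Duality for the fractional knapsack problem\<close>

text \<open>All items have value 1, so a greedy filling in the order of increasing cost is optimal. Let \<open>s\<close>
  be the cost at which the knapsack overflows. The cheaper items are taken completely, the ones of
  cost exactly \<open>s\<close> all in the same fraction \<open>\<tau>\<close> that exhausts the capacity, and \<open>1 / s\<close> is an optimal
  multiplier by complementary slackness. If everything fits, the multiplier is 0.\<close>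

lemma knapsack_duality:
  fixes d :: "'n::finite \<Rightarrow> real"
  assumes d: "\<And>n. 0 \<le> d n" and C: "0 < C"
  obtains \<mu> \<theta> where "0 \<le> \<mu>" "\<And>n. 0 \<le> \<theta> n" "\<And>n. \<theta> n \<le> 1" "(\<Sum>n\<in>UNIV. \<theta> n * d n) \<le> C"
    "\<mu> * C + (\<Sum>n\<in>UNIV. max 0 (1 - \<mu> * d n)) \<le> (\<Sum>n\<in>UNIV. \<theta> n)"
proof (cases "(\<Sum>n\<in>UNIV. d n) \<le> C")
  case True
  show ?thesis by (rule that[of 0 "\<lambda>_. 1"]) (use True in auto)
next
  case False
  \<comment> \<open>\<open>F s\<close> is the capacity needed for all items of cost at most \<open>s\<close>.\<close>
  define F where "F s = (\<Sum>n | d n \<le> s. d n)" for s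
  have F_max: "C < F (Max (range d))"
    using False by (simp add: F_def)
  define S where "S = {s \<in> range d. C < F s}"
  have "Max (range d) \<in> range d"
    by (rule Max_in) auto
  with F_max have "Max (range d) \<in> S"
    unfolding S_def by blast
  then have S: "finite S" "S \<noteq> {}"
    unfolding S_def by (simp, blast)
  define s where "s = Min S"
  have s: "s \<in> range d" "C < F s"
    using Min_in[OF S] by (auto simp: s_def S_def)
  have below: "F r \<le> C" if "r \<in> range d" "r < s" for r
  proof (rule ccontr)
    assume "\<not> F r \<le> C"
    with that(1) have "r \<in> S" unfolding S_def by simp
    with that(2) Min_le[OF S(1)] show False unfolding s_def by force
  qed
  define L where "L = {n. d n < s}"
  define E where "E = {n. d n = s}"
  define G where "G = (\<Sum>n\<in>L. d n)"
  \<comment> \<open>The cheaper items fit, since their largest cost lies below the critical one.\<close>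
  have G: "G \<le> C"
  proof (cases "L = {}")
    case True
    then show ?thesis using C by (simp add: G_def)
  next
    case False
    define r where "r = Max (d ` L)"
    have "r \<in> d ` L" unfolding r_def using False by (intro Max_in) auto
    moreover have "d n \<le> r" if "n \<in> L" for n
      unfolding r_def using that by (intro Max_ge) auto
    with \<open>r \<in> d ` L\<close> have "{n. d n \<le> r} = L"
      by (auto simp: L_def)
    ultimately show ?thesis using below[of r] by (auto simp: F_def G_def L_def)
  qed
  have "E \<noteq> {}" using s(1) by (auto simp: E_def)
  then have m: "0 < card E" by (simp add: card_gt_0_iff)
  have split: "{n. d n \<le> s} = L \<union> E" "L \<inter> E = {}" by (auto simp: L_def E_def)
  have Fs: "F s = G + card E * s"
    unfolding F_def split(1) G_def using split(2) by (subst sum.union_disjoint) (auto simp: E_def)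
  have s_pos: "0 < s"
  proof -
    have "s \<noteq> 0" using Fs s(2) G by auto
    moreover have "0 \<le> s" using s(1) d by auto
    ultimately show ?thesis by simp
  qed
  define \<tau> where "\<tau> = (C - G) / (card E * s)"
  have \<tau>: "0 \<le> \<tau>" "\<tau> \<le> 1" "\<tau> * (card E * s) = C - G"
    using G Fs s(2) s_pos m \<open>E \<noteq> {}\<close> by (simp_all add: \<tau>_def divide_le_eq)
  define \<theta> where "\<theta> n = (if n \<in> L then 1 else if n \<in> E then \<tau> else 0)" for n
  have sum\<theta>: "(\<Sum>n\<in>UNIV. \<theta> n * h n) = (\<Sum>n\<in>L. h n) + \<tau> * (\<Sum>n\<in>E. h n)" for h
  proof -
    have "(\<Sum>n\<in>UNIV. \<theta> n * h n) = (\<Sum>n\<in>L \<union> E. \<theta> n * h n)"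
      by (rule sum.mono_neutral_right) (auto simp: \<theta>_def)
    also have "\<dots> = (\<Sum>n\<in>L. \<theta> n * h n) + (\<Sum>n\<in>E. \<theta> n * h n)"
      using split(2) by (intro sum.union_disjoint) auto
    also have "(\<Sum>n\<in>L. \<theta> n * h n) = (\<Sum>n\<in>L. h n)"
      by (intro sum.cong) (auto simp: \<theta>_def)
    also have "(\<Sum>n\<in>E. \<theta> n * h n) = (\<Sum>n\<in>E. \<tau> * h n)"
      using split(2) by (intro sum.cong) (auto simp: \<theta>_def)
    finally show ?thesis by (simp add: sum_distrib_left)
  qed
  have cost: "(\<Sum>n\<in>UNIV. \<theta> n * d n) = C"
    using \<tau>(3) sum\<theta>[of d] by (simp add: G_def E_def)
  have "(\<Sum>n\<in>UNIV. max 0 (1 - 1 / s * d n)) = (\<Sum>n\<in>L. 1 - d n / s)"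
    using s_pos by (intro sum.mono_neutral_cong_right) (auto simp: L_def field_simps)
  also have "\<dots> = card L - G / s"
    by (simp add: sum_subtractf G_def sum_divide_distrib)
  also have "1 / s * C + (card L - G / s) = card L + \<tau> * card E"
    using \<tau>(3) s_pos by (simp add: field_simps)
  also have "\<dots> = (\<Sum>n\<in>UNIV. \<theta> n)"
    using sum\<theta>[of "\<lambda>_. 1"] by simp
  finally have val: "1 / s * C + (\<Sum>n\<in>UNIV. max 0 (1 - 1 / s * d n)) = (\<Sum>n\<in>UNIV. \<theta> n)"
    by simp
  show ?thesis
    by (rule that[of "1 / s" \<theta>]) (use \<tau> s_pos cost val in \<open>auto simp: \<theta>_def\<close>)
qed

section \<open>The worst-case violation probability over the Wasserstein ball\<close>

context gauge
begin

text \<open>Draw a sample index \<open>n\<close> uniformly and then, with probability \<open>w n\<close>, replace \<open>\<xi> $ n\<close> by \<open>y n\<close>. The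
  joint law of the result and the original sample is a coupling with the empirical distribution whose
  cost is the average of \<open>w n\<close> times the distance moved.\<close>

lemma partial_transport:
  fixes \<xi> :: "real ^ 'l ^ 'n" and y :: "'n \<Rightarrow> real ^ 'l" and w :: "'n \<Rightarrow> real"
  assumes w: "\<And>n. 0 \<le> w n" "\<And>n. w n \<le> 1"
    and cost: "(\<Sum>n\<in>UNIV. w n * nrm (y n - \<xi> $ n)) \<le> \<epsilon> * real CARD('n)"
  obtains f where "f \<in> wasserstein_ball nrm \<xi> \<epsilon>"
    "\<And>B. B \<in> sets borel \<Longrightarrow> range y \<subseteq> B \<Longrightarrow> (\<Sum>n\<in>UNIV. w n) \<le> real CARD('n) * measure f B"
proof -
  define U where "U = pmf_of_set (UNIV :: 'n set)"
  define R where "R = bind_pmf U (\<lambda>n. map_pmf (Pair n) (bernoulli_pmf (w n)))"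
  define h where "h = (\<lambda>(n, m). (if m then y n else \<xi> $ n, \<xi> $ n))"
  define Q where "Q = distr (measure_pmf R) (borel \<Otimes>\<^sub>M borel) h"
  define f where "f = distr Q borel fst"
  have h [measurable]: "h \<in> measurable (measure_pmf R) (borel \<Otimes>\<^sub>M borel)"
    by (simp add: space_pair_measure)
  have h_space [simp]: "h r \<in> space (borel \<Otimes>\<^sub>M borel)" for r
    by (simp add: space_pair_measure)
  have avg: "(\<integral>\<^sup>+ r. ennreal (k r) \<partial>measure_pmf R)
      = ennreal ((\<Sum>n\<in>UNIV. w n * k (n, True) + (1 - w n) * k (n, False)) / real CARD('n))"
    if "\<And>r. 0 \<le> k r" for k
  proof -
    have "(\<integral>\<^sup>+ r. ennreal (k r) \<partial>measure_pmf R)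
        = (\<integral>\<^sup>+ n. ennreal (w n * k (n, True) + (1 - w n) * k (n, False)) \<partial>measure_pmf U)"
      unfolding R_def using w that
      by (simp add: ennreal_plus ennreal_mult' mult.commute flip: ennreal_1 ennreal_minus)
    also have "\<dots> = ennreal ((\<Sum>n\<in>UNIV. w n * k (n, True) + (1 - w n) * k (n, False)) / real CARD('n))"
      unfolding U_def using w that
      by (simp add: nn_integral_pmf_of_set sum_ennreal divide_ennreal sum_nonneg ennreal_of_nat_eq_real_of_nat
          del: ennreal_plus)
    finally show ?thesis .
  qed
  have Q_prob: "prob_space Q"
    unfolding Q_def by (rule measure_pmf.prob_space_distr[OF h])
  have [measurable_cong]: "sets Q = sets (borel \<Otimes>\<^sub>M borel)"
    by (simp add: Q_def)
  have "distr Q borel snd = distr (measure_pmf R) borel (\<lambda>r. \<xi> $ fst r)"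
    unfolding Q_def by (subst distr_distr) (auto simp: h_def case_prod_beta comp_def space_pair_measure)
  also have "\<dots> = distr (measure_pmf (map_pmf fst R)) borel (\<lambda>n. \<xi> $ n)"
    by (simp add: map_pmf_rep_eq distr_distr comp_def)
  also have "map_pmf fst R = U"
    by (simp add: R_def map_bind_pmf map_pmf_comp bind_return_pmf')
  finally have snd_Q: "distr Q borel snd = empirical \<xi>"
    by (simp add: empirical_eq_pmf U_def)
  have Q_coupling: "Q \<in> couplings f (empirical \<xi>)"
    using Q_prob snd_Q by (simp add: couplings_def f_def \<open>sets Q = _\<close>)
  have "(\<integral>\<^sup>+ v. ennreal (nrm (fst v - snd v)) \<partial>Q)
      = (\<integral>\<^sup>+ r. ennreal (nrm (fst (h r) - snd (h r))) \<partial>measure_pmf R)"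
    unfolding Q_def by (subst nn_integral_distr) auto
  also have "\<dots> = ennreal ((\<Sum>n\<in>UNIV. w n * nrm (y n - \<xi> $ n)) / real CARD('n))"
    by (subst avg) (auto simp: nrm_nonneg h_def)
  also have "\<dots> \<le> ennreal \<epsilon>"
    using cost by (intro ennreal_leI) (simp add: divide_le_eq)
  finally have "wasserstein nrm f (empirical \<xi>) \<le> ennreal \<epsilon>"
    unfolding wasserstein_def by (rule INF_lower2[OF Q_coupling])
  moreover have f_prob: "prob_space f"
    unfolding f_def by (intro prob_space.prob_space_distr[OF Q_prob]) simp
  ultimately have "f \<in> wasserstein_ball nrm \<xi> \<epsilon>"
    by (simp add: wasserstein_ball_def f_def)
  moreover have "(\<Sum>n\<in>UNIV. w n) \<le> real CARD('n) * measure f B"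
    if [measurable]: "B \<in> sets borel" and y: "range y \<subseteq> B" for B
  proof -
    have "emeasure f B = (\<integral>\<^sup>+ r. indicator B (fst (h r)) \<partial>measure_pmf R)"
      unfolding f_def Q_def by (subst distr_distr) (auto simp: emeasure_distr nn_integral_distr simp flip: nn_integral_indicator)
    also have "\<dots> = (\<integral>\<^sup>+ r. ennreal (indicator B (fst (h r))) \<partial>measure_pmf R)"
      by (simp add: ennreal_indicator)
    also have "\<dots> = ennreal ((\<Sum>n\<in>UNIV. w n + (1 - w n) * indicator B (\<xi> $ n)) / real CARD('n))"
      using y by (subst avg) (auto simp: h_def image_subset_iff)
    finally have "measure f B = (\<Sum>n\<in>UNIV. w n + (1 - w n) * indicator B (\<xi> $ n)) / real CARD('n)"
      using w by (simp add: measure_def sum_nonneg)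
    moreover have "(\<Sum>n\<in>UNIV. w n) \<le> (\<Sum>n\<in>UNIV. w n + (1 - w n) * indicator B (\<xi> $ n))"
      using w by (intro sum_mono) simp
    ultimately show ?thesis by simp
  qed
  ultimately show ?thesis by (rule that)
qed

text \<open>Moving no mass leaves the empirical distribution itself. Nonemptiness matters because the infimum in the
  chance constraint is one of real numbers, with no useful value on the empty set.\<close>

lemma wasserstein_ball_nonempty:
  assumes "0 \<le> \<epsilon>"
  shows "wasserstein_ball nrm \<xi> \<epsilon> \<noteq> {}"
  using partial_transport[of "\<lambda>_. 0" "\<lambda>_. 0" \<xi> \<epsilon>] assms by force

text \<open>Weak duality. If \<open>\<eta>\<close> violates the constraint and \<open>\<zeta>\<close> is arbitrary, then \<open>gap a b \<zeta> \<le> nrm (\<eta> - \<zeta>)\<close>, whence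
  \<open>1 \<le> \<mu> * nrm (\<eta> - \<zeta>) + max 0 (1 - \<mu> * gap a b \<zeta>)\<close>. Integrating over a coupling bounds the violation
  probability by \<open>\<mu>\<close> times the transport cost plus an average over the samples.\<close>

lemma violation_le_dual_value:
  fixes \<xi> :: "real ^ 'l ^ 'n"
  assumes f: "f \<in> wasserstein_ball nrm \<xi> \<epsilon>" and a: "a \<noteq> 0" and mu: "0 \<le> \<mu>" and \<epsilon>: "0 \<le> \<epsilon>"
  shows "measure f {\<zeta>. a \<bullet> \<zeta> < b}
    \<le> \<mu> * \<epsilon> + (\<Sum>n\<in>UNIV. max 0 (1 - \<mu> * gap a b (\<xi> $ n))) / real CARD('n)"
proof -
  define V where "V = {\<zeta> :: real ^ 'l. a \<bullet> \<zeta> < b}"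
  have [measurable]: "V \<in> sets borel" unfolding V_def by measurable
  define h where "h \<zeta> = max 0 (1 - \<mu> * gap a b \<zeta>)" for \<zeta>
  have [measurable]: "h \<in> borel_measurable borel"
    unfolding h_def[abs_def] gap_def by measurable
  have h_nonneg: "0 \<le> h \<zeta>" for \<zeta> by (simp add: h_def)
  let ?S = "(\<Sum>n\<in>UNIV. h (\<xi> $ n)) / real CARD('n)"
  have S: "0 \<le> ?S" by (simp add: sum_nonneg h_nonneg)
  from f have f_prob: "prob_space f" and f_sets: "sets f = sets borel"
    and W: "wasserstein nrm f (empirical \<xi>) \<le> ennreal \<epsilon>"
    by (auto simp: wasserstein_ball_def)
  interpret f: prob_space f by fact
  have "measure f V \<le> \<mu> * \<epsilon> + ?S + \<delta>" if "0 < \<delta>" for \<delta>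
  proof -
    \<comment> \<open>The distance is an infimum over couplings; some coupling costs at most \<open>\<rho>\<close> more than \<open>\<epsilon>\<close>.\<close>
    define \<rho> where "\<rho> = \<delta> / (\<mu> + 1)"
    have \<rho>: "0 < \<rho>" "\<mu> * \<rho> \<le> \<delta>"
      using that mu by (auto simp: \<rho>_def field_simps)
    have "ennreal \<epsilon> < ennreal (\<epsilon> + \<rho>)"
      using \<rho> \<epsilon> by (simp add: ennreal_less_iff)
    with W have "wasserstein nrm f (empirical \<xi>) < ennreal (\<epsilon> + \<rho>)"
      by (rule le_less_trans)
    then obtain Q where Q: "Q \<in> couplings f (empirical \<xi>)"
      and cost: "(\<integral>\<^sup>+ v. ennreal (nrm (fst v - snd v)) \<partial>Q) < ennreal (\<epsilon> + \<rho>)"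
      by (auto simp: wasserstein_def INF_less_iff)
    from Q have [measurable_cong]: "sets Q = sets (borel \<Otimes>\<^sub>M borel)"
      and fst_Q: "distr Q borel fst = f" and snd_Q: "distr Q borel snd = empirical \<xi>"
      by (auto simp: couplings_def)
    have "emeasure f V = (\<integral>\<^sup>+ v. indicator V (fst v) \<partial>Q)"
      unfolding fst_Q[symmetric]
      by (subst nn_integral_indicator[symmetric], simp, subst nn_integral_distr) auto
    also have "\<dots> \<le> (\<integral>\<^sup>+ v. ennreal \<mu> * ennreal (nrm (fst v - snd v)) + ennreal (h (snd v)) \<partial>Q)"
    proof (rule nn_integral_mono)
      fix v :: "(real ^ 'l) \<times> (real ^ 'l)"
      show "indicator V (fst v) \<le> ennreal \<mu> * ennreal (nrm (fst v - snd v)) + ennreal (h (snd v))"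
      proof (cases "fst v \<in> V")
        case True
        then have "gap a b (snd v) \<le> nrm (fst v - snd v)"
          using a by (intro gap_le_distance) (auto simp: V_def)
        then have "\<mu> * gap a b (snd v) \<le> \<mu> * nrm (fst v - snd v)"
          using mu by (rule mult_left_mono)
        then have "1 \<le> \<mu> * nrm (fst v - snd v) + h (snd v)"
          by (simp add: h_def)
        then have "ennreal 1 \<le> ennreal (\<mu> * nrm (fst v - snd v) + h (snd v))"
          by (rule ennreal_leI)
        then show ?thesis
          using True mu by (simp add: ennreal_plus ennreal_mult nrm_nonneg h_nonneg)
      qed simp
    qed
    also have "\<dots> = ennreal \<mu> * (\<integral>\<^sup>+ v. ennreal (nrm (fst v - snd v)) \<partial>Q) + (\<integral>\<^sup>+ v. ennreal (h (snd v)) \<partial>Q)"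
      by (simp add: nn_integral_add nn_integral_cmult)
    also have "(\<integral>\<^sup>+ v. ennreal (h (snd v)) \<partial>Q) = (\<integral>\<^sup>+ \<zeta>. ennreal (h \<zeta>) \<partial>empirical \<xi>)"
      unfolding snd_Q[symmetric] by (subst nn_integral_distr) auto
    also have "\<dots> = ennreal ?S"
      by (rule nn_integral_empirical) (auto simp: h_nonneg)
    also have "ennreal \<mu> * (\<integral>\<^sup>+ v. ennreal (nrm (fst v - snd v)) \<partial>Q) + ennreal ?S
        \<le> ennreal \<mu> * ennreal (\<epsilon> + \<rho>) + ennreal ?S"
      using cost by (intro add_mono mult_left_mono) auto
    also have "\<dots> = ennreal (\<mu> * (\<epsilon> + \<rho>) + ?S)"
      using mu \<epsilon> \<rho> S by (simp add: ennreal_mult ennreal_plus)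
    finally have "measure f V \<le> \<mu> * (\<epsilon> + \<rho>) + ?S"
      unfolding f.emeasure_eq_measure using mu \<epsilon> \<rho> S by (subst (asm) ennreal_le_iff) auto
    then show ?thesis using \<rho>(2) by (simp add: algebra_simps)
  qed
  then have "measure f V \<le> \<mu> * \<epsilon> + ?S"
    by (rule field_le_epsilon)
  then show ?thesis by (simp add: V_def h_def)
qed

text \<open>Strong duality, primal side: the fractions \<open>\<theta>\<close> of a feasible knapsack filling can be moved into
  the violating half-space up to an arbitrarily small loss. The factor \<open>r < 1\<close> on the mass pays for
  overshooting each distance by \<open>(1 - r) * \<epsilon>\<close>: the total cost is at most
  \<open>r * (1 + (1 - r)) = 1 - (1 - r)\<^sup>2 \<le> 1\<close> times the budget.\<close>

lemma violation_ge_knapsack_value: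
  fixes \<xi> :: "real ^ 'l ^ 'n" and \<theta> :: "'n \<Rightarrow> real"
  assumes a: "a \<noteq> 0" and \<epsilon>: "0 < \<epsilon>"
    and \<theta>: "\<And>n. 0 \<le> \<theta> n" "\<And>n. \<theta> n \<le> 1"
    and cost: "(\<Sum>n\<in>UNIV. \<theta> n * gap a b (\<xi> $ n)) \<le> \<epsilon> * real CARD('n)"
    and viol: "\<And>f. f \<in> wasserstein_ball nrm \<xi> \<epsilon> \<Longrightarrow> measure f {\<zeta>. a \<bullet> \<zeta> < b} \<le> \<alpha>"
  shows "(\<Sum>n\<in>UNIV. \<theta> n) \<le> \<alpha> * real CARD('n)"
proof (rule field_le_mult_one_interval)
  fix r :: real assume r: "0 < r" "r < 1"
  have "\<exists>\<eta>. a \<bullet> \<eta> < b \<and> nrm (\<eta> - \<xi> $ n) \<le> gap a b (\<xi> $ n) + (1 - r) * \<epsilon>" for n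
    using violation_near[OF a, of b "\<xi> $ n" "gap a b (\<xi> $ n) + (1 - r) * \<epsilon>"] r \<epsilon> by auto
  then obtain y where y: "\<And>n. a \<bullet> y n < b"
      "\<And>n. nrm (y n - \<xi> $ n) \<le> gap a b (\<xi> $ n) + (1 - r) * \<epsilon>"
    by metis
  have "(\<Sum>n\<in>UNIV. r * \<theta> n * nrm (y n - \<xi> $ n))
      \<le> (\<Sum>n\<in>UNIV. r * (\<theta> n * gap a b (\<xi> $ n) + (1 - r) * \<epsilon>))"
  proof (rule sum_mono)
    fix n
    have "\<theta> n * nrm (y n - \<xi> $ n) \<le> \<theta> n * (gap a b (\<xi> $ n) + (1 - r) * \<epsilon>)"
      using y(2) \<theta>(1) by (rule mult_left_mono)
    also have "\<dots> \<le> \<theta> n * gap a b (\<xi> $ n) + (1 - r) * \<epsilon>"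
      using \<theta>[of n] r \<epsilon> by (simp add: distrib_left mult_left_le_one_le)
    finally show "r * \<theta> n * nrm (y n - \<xi> $ n) \<le> r * (\<theta> n * gap a b (\<xi> $ n) + (1 - r) * \<epsilon>)"
      using r by (simp add: mult.assoc)
  qed
  also have "\<dots> = r * ((\<Sum>n\<in>UNIV. \<theta> n * gap a b (\<xi> $ n)) + real CARD('n) * ((1 - r) * \<epsilon>))"
    by (simp add: sum.distrib flip: sum_distrib_left)
  also have "\<dots> \<le> r * (\<epsilon> * real CARD('n) + real CARD('n) * ((1 - r) * \<epsilon>))"
    using cost r by (intro mult_left_mono add_right_mono) auto
  also have "\<dots> = (1 - (1 - r)\<^sup>2) * (\<epsilon> * real CARD('n))"
    by (simp add: power2_eq_square algebra_simps)
  also have "\<dots> \<le> \<epsilon> * real CARD('n)"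
    using \<epsilon> by (simp add: mult_left_le_one_le mult_le_cancel_right1)
  finally obtain f where f: "f \<in> wasserstein_ball nrm \<xi> \<epsilon>"
    and large: "\<And>B. B \<in> sets borel \<Longrightarrow> range y \<subseteq> B \<Longrightarrow> (\<Sum>n\<in>UNIV. r * \<theta> n) \<le> real CARD('n) * measure f B"
    using partial_transport[of "\<lambda>n. r * \<theta> n" y \<xi> \<epsilon>] \<theta> r by (auto simp: mult_le_one)
  have "(\<Sum>n\<in>UNIV. r * \<theta> n) \<le> real CARD('n) * measure f {\<zeta>. a \<bullet> \<zeta> < b}"
    by (rule large) (use y(1) in auto)
  also have "\<dots> \<le> real CARD('n) * \<alpha>"
    using viol[OF f] by (intro mult_left_mono) auto
  finally show "r * (\<Sum>n\<in>UNIV. \<theta> n) \<le> \<alpha> * real CARD('n)"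
    by (simp add: sum_distrib_left mult.commute)
qed

text \<open>The multiplier from \<open>knapsack_duality\<close> proves one direction, since its dual value is at most the
  value of a feasible filling and hence at most \<open>\<alpha> N\<close>; weak duality proves the other.\<close>

lemma worst_case_chance_dual:
  fixes \<xi> :: "real ^ 'l ^ 'n"
  assumes a: "a \<noteq> 0" and \<epsilon>: "0 < \<epsilon>"
  shows "1 - \<alpha> \<le> (INF f\<in>wasserstein_ball nrm \<xi> \<epsilon>. measure f {\<zeta>. a \<bullet> \<zeta> \<ge> b}) \<longleftrightarrow>
    (\<exists>\<mu>\<ge>0. \<mu> * (\<epsilon> * real CARD('n)) + (\<Sum>n\<in>UNIV. max 0 (1 - \<mu> * gap a b (\<xi> $ n))) \<le> \<alpha> * real CARD('n))"
    (is "?L \<longleftrightarrow> ?R")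
proof -
  have compl: "measure f {\<zeta>. a \<bullet> \<zeta> \<ge> b} = 1 - measure f {\<zeta>. a \<bullet> \<zeta> < b}"
    if "f \<in> wasserstein_ball nrm \<xi> \<epsilon>" for f
  proof -
    from that have "prob_space f" and [measurable_cong]: "sets f = sets borel"
      by (auto simp: wasserstein_ball_def)
    interpret prob_space f by fact
    have "space f = UNIV" using sets_eq_imp_space_eq[OF \<open>sets f = sets borel\<close>] by simp
    then show ?thesis
      using prob_compl[of "{\<zeta>. a \<bullet> \<zeta> < b}"] \<open>sets f = sets borel\<close>
      by (simp add: Compl_eq_Diff_UNIV[symmetric] Collect_neg_eq[symmetric] not_less)
  qed
  have bdd: "bdd_below ((\<lambda>f. measure f {\<zeta>. a \<bullet> \<zeta> \<ge> b}) ` wasserstein_ball nrm \<xi> \<epsilon>)"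
    by (rule bdd_belowI2[where m = 0]) simp
  show ?thesis
  proof
    assume L: ?L
    have viol: "measure f {\<zeta>. a \<bullet> \<zeta> < b} \<le> \<alpha>" if f: "f \<in> wasserstein_ball nrm \<xi> \<epsilon>" for f
      using order_trans[OF L cINF_lower[OF bdd f]] compl[OF f] by simp
    have budget: "0 < \<epsilon> * real CARD('n)" using \<epsilon> by simp
    obtain \<mu> \<theta> where "0 \<le> \<mu>" and \<theta>: "\<And>n. 0 \<le> \<theta> n" "\<And>n. \<theta> n \<le> 1"
        "(\<Sum>n\<in>UNIV. \<theta> n * gap a b (\<xi> $ n)) \<le> \<epsilon> * real CARD('n)"
      and val: "\<mu> * (\<epsilon> * real CARD('n)) + (\<Sum>n\<in>UNIV. max 0 (1 - \<mu> * gap a b (\<xi> $ n))) \<le> (\<Sum>n\<in>UNIV. \<theta> n)"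
      by (rule knapsack_duality[of "\<lambda>n. gap a b (\<xi> $ n)", OF gap_nonneg budget]) blast
    with violation_ge_knapsack_value[OF a \<epsilon> \<theta> viol] show ?R
      by (intro exI[of _ \<mu>]) auto
  next
    assume ?R
    then obtain \<mu> where mu: "0 \<le> \<mu>"
      and le: "\<mu> * (\<epsilon> * real CARD('n)) + (\<Sum>n\<in>UNIV. max 0 (1 - \<mu> * gap a b (\<xi> $ n))) \<le> \<alpha> * real CARD('n)"
      by blast
    from le have "\<mu> * \<epsilon> + (\<Sum>n\<in>UNIV. max 0 (1 - \<mu> * gap a b (\<xi> $ n))) / real CARD('n) \<le> \<alpha>"
      by (simp add: field_simps)
    with violation_le_dual_value[OF _ a mu, of _ \<xi> \<epsilon> b] \<epsilon>
    have "measure f {\<zeta>. a \<bullet> \<zeta> < b} \<le> \<alpha>" if "f \<in> wasserstein_ball nrm \<xi> \<epsilon>" for f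
      using that by fastforce
    then show ?L
      using \<epsilon> by (intro cINF_greatest wasserstein_ball_nonempty) (auto simp: compl)
  qed
qed

end

section \<open>The p-norms\<close>

lemma gauge_pnorm:
  assumes "1 \<le> p"
  shows "gauge (pnorm p :: real ^ 'l \<Rightarrow> real)"
proof (cases "p = \<infinity>")
  case True
  then have eq: "pnorm p = (infnorm :: real ^ 'l \<Rightarrow> real)"
    by (simp add: pnorm_def fun_eq_iff)
  show ?thesis
    unfolding eq
    by unfold_locales
       (auto simp: infnorm_mul component_le_infnorm_cart
          intro!: borel_measurable_continuous_onI continuous_intros)
next
  case False
  with assms obtain r where p: "p = ereal r" and r: "1 \<le> r"
    by (cases p) auto
  have eq: "pnorm p v = (\<Sum>i\<in>UNIV. \<bar>v $ i\<bar> powr r) powr (1 / r)" for v :: "real ^ 'l"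
    by (simp add: pnorm_def p)
  show ?thesis
  proof
    fix s :: real and u :: "real ^ 'l" and i
    show "pnorm p (s *\<^sub>R u) = \<bar>s\<bar> * pnorm p u"
    proof -
      have "(\<Sum>i\<in>UNIV. \<bar>(s *\<^sub>R u) $ i\<bar> powr r) = \<bar>s\<bar> powr r * (\<Sum>i\<in>UNIV. \<bar>u $ i\<bar> powr r)"
        by (simp add: abs_mult powr_mult sum_distrib_left)
      then show ?thesis
        using r by (simp add: eq powr_mult powr_powr sum_nonneg)
    qed
    have "\<bar>u $ i\<bar> powr r \<le> (\<Sum>i\<in>UNIV. \<bar>u $ i\<bar> powr r)"
      by (rule member_le_sum) auto
    then have "(\<bar>u $ i\<bar> powr r) powr (1 / r) \<le> pnorm p u"
      unfolding eq using r by (intro powr_mono2) auto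
    then show "\<bar>u $ i\<bar> \<le> pnorm p u"
      using r by (simp add: powr_powr)
  next
    have "(\<lambda>v :: real ^ 'l. (\<Sum>i\<in>UNIV. \<bar>v $ i\<bar> powr r) powr (1 / r)) \<in> borel_measurable borel"
      by measurable
    then show "pnorm p \<in> borel_measurable (borel :: (real ^ 'l) measure)"
      by (simp add: eq[abs_def])
  qed
qed

section \<open>The mixed integer formulation\<close>

lemma finite_binary_vectors: "finite {x :: real ^ 'd. \<forall>k. x $ k \<in> {0, 1}}"
proof (rule finite_subset)
  show "{x :: real ^ 'd. \<forall>k. x $ k \<in> {0, 1}} \<subseteq> vec_lambda ` (UNIV \<rightarrow>\<^sub>E {0, 1})"
    by (auto simp: image_iff intro!: bexI[of _ "vec_nth _"])
  show "finite (vec_lambda ` (UNIV \<rightarrow>\<^sub>E {0, 1}) :: (real ^ 'd) set)"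
    by (intro finite_imageI finite_PiE) auto
qed

lemma A_of_scale: "A_of Abar (t *\<^sub>R x) = t *\<^sub>R A_of Abar x"
  by (simp add: A_of_def matrix_vector_mult_scaleR)

text \<open>The two big-M rows of a sample with slack \<open>r\<close> encode the hinge bound on \<open>\<beta>\<close>: each value of the binary
  variable leaves one of the rows intact, and each row by itself implies the bound.\<close>

lemma hinge_le_of_big_M_rows:
  fixes t r z M \<beta> :: real
  assumes "0 \<le> t" "0 \<le> \<beta>" "z \<in> {0, 1}" "1 \<le> t * r + z * M + \<beta>" "1 \<le> (1 - z) * M + \<beta>"
  shows "max 0 (1 - t * max 0 r) \<le> \<beta>"
proof (cases "z = 0")
  case True
  have "t * r \<le> t * max 0 r" using assms(1) by (intro mult_left_mono) auto
  with True assms show ?thesis by simp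
next
  case False
  have "0 \<le> t * max 0 r" using assms(1) by simp
  moreover have "1 \<le> \<beta>" using False assms by simp
  ultimately show ?thesis using assms(2) by linarith
qed

text \<open>With \<open>\<beta>\<close> equal to the hinge term, the right row to keep is read off from the sign of the slack. The
  other row is absorbed by \<open>M\<close>, because \<open>\<bar>t * r\<bar>\<close> cannot exceed \<open>T * \<bar>r\<bar>\<close>.\<close>

lemma big_M_rows_of_hinge:
  fixes t r M T :: real
  assumes "0 \<le> t" "t \<le> T" "1 + T * \<bar>r\<bar> \<le> M"
  defines "z \<equiv> if 0 \<le> r then 0 else 1"
  defines "\<beta> \<equiv> max 0 (1 - t * max 0 r)"
  shows "1 \<le> t * r + z * M + \<beta>" "1 \<le> (1 - z) * M + \<beta>"
proof -
  have "t * \<bar>r\<bar> \<le> T * \<bar>r\<bar>" using assms(2) by (intro mult_right_mono) auto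
  moreover have "0 \<le> t * \<bar>r\<bar>" using assms(1) by simp
  ultimately show "1 \<le> t * r + z * M + \<beta>" "1 \<le> (1 - z) * M + \<beta>"
    using assms(3) by (auto simp: z_def \<beta>_def max_def)
qed

text \<open>The McCormick inequalities are exact at binary points: \<open>x $ k = 1\<close> forces \<open>\<pi> $ k = t\<close> and
  \<open>x $ k = 0\<close> forces \<open>\<pi> $ k = 0\<close>.\<close>

lemma binary_product_linearization:
  fixes x \<pi> :: "real ^ 'd"
  assumes x: "\<forall>k. x $ k \<in> {0, 1}"
    and \<pi>: "\<forall>k. \<pi> $ k \<ge> t + (x $ k - 1) * M \<and> \<pi> $ k \<le> x $ k * M \<and> \<pi> $ k \<le> t \<and> \<pi> $ k \<ge> 0"
  shows "\<pi> = t *\<^sub>R x"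
  unfolding vec_eq_iff
proof
  fix k
  from x have "x $ k = 0 \<or> x $ k = 1" by auto
  then show "\<pi> $ k = (t *\<^sub>R x) $ k"
    using spec[OF \<pi>, of k] by auto
qed

lemma scaled_slack:
  "A_of Abar (t *\<^sub>R x) \<bullet> \<zeta> - (q * t - bbar \<bullet> (t *\<^sub>R x)) = t * (A_of Abar x \<bullet> \<zeta> - b_of q bbar x)"
  by (simp add: A_of_scale b_of_def algebra_simps)

text \<open>The substitution \<open>\<mu> = t * dual_norm nrm a\<close> in \<open>worst_case_chance_dual\<close> cancels the denominator of
  the gap, so that \<open>t\<close> enters the hinge terms only through its product with \<open>a \<bullet> \<xi> $ n - b\<close>.\<close>

lemma (in gauge) worst_case_chance_scaled:
  fixes \<xi> :: "real ^ 'l ^ 'n"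
  assumes a: "a \<noteq> 0" and \<epsilon>: "0 < \<epsilon>"
  shows "1 - \<alpha> \<le> (INF f\<in>wasserstein_ball nrm \<xi> \<epsilon>. measure f {\<zeta>. a \<bullet> \<zeta> \<ge> b}) \<longleftrightarrow>
    (\<exists>t\<ge>0. \<epsilon> * real CARD('n) * dual_norm nrm (t *\<^sub>R a)
      + (\<Sum>n\<in>UNIV. max 0 (1 - t * max 0 (a \<bullet> \<xi> $ n - b))) \<le> \<alpha> * real CARD('n))"
    (is "_ \<longleftrightarrow> (\<exists>t\<ge>0. ?P t)")
proof -
  let ?D = "dual_norm nrm a"
  let ?Q = "\<lambda>\<mu>. \<mu> * (\<epsilon> * real CARD('n)) + (\<Sum>n\<in>UNIV. max 0 (1 - \<mu> * gap a b (\<xi> $ n))) \<le> \<alpha> * real CARD('n)"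
  have D: "0 < ?D" using a by (rule dual_pos)
  have PQ: "?P t \<longleftrightarrow> ?Q (t * ?D)" if "0 \<le> t" for t
    using D that by (simp add: dual_scale gap_def mult_ac)
  have "(\<exists>\<mu>\<ge>0. ?Q \<mu>) \<longleftrightarrow> (\<exists>t\<ge>0. ?P t)"
  proof
    assume "\<exists>\<mu>\<ge>0. ?Q \<mu>"
    then obtain \<mu> where "0 \<le> \<mu>" "?Q \<mu>" by blast
    then show "\<exists>t\<ge>0. ?P t"
      using D PQ[of "\<mu> / ?D"] by (intro exI[of _ "\<mu> / ?D"]) simp
  next
    assume "\<exists>t\<ge>0. ?P t"
    then obtain t where "0 \<le> t" "?P t" by blast
    then show "\<exists>\<mu>\<ge>0. ?Q \<mu>"
      using D PQ[of t] by (intro exI[of _ "t * ?D"]) simp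
  qed
  then show ?thesis
    by (simp only: worst_case_chance_dual[OF a \<epsilon>])
qed

lemma (in gauge) mic_feasible_imp_drcc_feasible:
  fixes \<xi> :: "real ^ 'l ^ 'n" and X :: "(real ^ 'd) set"
  assumes \<epsilon>: "0 < \<epsilon>" and X: "X \<subseteq> {x. \<forall>k. x $ k \<in> {0, 1}}" and A: "\<forall>x\<in>X. A_of Abar x \<noteq> 0"
    and feas: "(x, \<pi>, z, \<beta>, t, \<alpha>) \<in> mic_feasible nrm X \<alpha>bar Abar bbar q \<xi> \<epsilon> M0 M2"
  shows "(x, \<alpha>) \<in> drcc_feasible nrm X \<alpha>bar Abar bbar q \<xi> \<epsilon>"
proof -
  let ?r = "\<lambda>n. A_of Abar x \<bullet> \<xi> $ n - b_of q bbar x"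
  from feas have x: "x \<in> X" and t: "0 \<le> t" and \<alpha>: "\<alpha> \<in> {0<..\<alpha>bar}"
    by (auto simp: mic_feasible_def)
  have \<pi>: "\<pi> = t *\<^sub>R x"
    by (rule binary_product_linearization[where M = M0])
       (use feas X in \<open>auto simp: mic_feasible_def\<close>)
  have row: "1 \<le> A_of Abar \<pi> \<bullet> \<xi> $ n - (q * t - bbar \<bullet> \<pi>) + z $ n * M2 $ n + \<beta> $ n"
    and rest: "0 \<le> \<beta> $ n" "z $ n \<in> {0, 1}" "1 \<le> (1 - z $ n) * M2 $ n + \<beta> $ n" for n
    using feas by (auto simp: mic_feasible_def)
  have "max 0 (1 - t * max 0 (?r n)) \<le> \<beta> $ n" for n
    using t rest(1,2) row[unfolded \<pi> scaled_slack] rest(3) by (rule hinge_le_of_big_M_rows)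
  then have "(\<Sum>n\<in>UNIV. max 0 (1 - t * max 0 (?r n))) \<le> (\<Sum>n\<in>UNIV. \<beta> $ n)"
    by (intro sum_mono)
  moreover have "\<epsilon> * real CARD('n) * dual_norm nrm (t *\<^sub>R A_of Abar x) + (\<Sum>n\<in>UNIV. \<beta> $ n)
      \<le> \<alpha> * real CARD('n)"
    using feas by (simp add: mic_feasible_def \<pi> A_of_scale)
  ultimately show ?thesis
    using worst_case_chance_scaled[of "A_of Abar x" \<epsilon> \<alpha> "b_of q bbar x" \<xi>] x \<alpha> t \<epsilon> A
    by (auto simp: drcc_feasible_def intro!: exI[of _ t])
qed

text \<open>The extension takes \<open>\<pi> = t x\<close>, \<open>\<beta>\<close> equal to the hinge terms and \<open>z\<close> marking the violated samples. The budget
  row together with \<open>\<alpha> \<le> 1\<close> bounds \<open>t\<close> by \<open>1 / (\<epsilon> * dual_norm nrm (A_of Abar x))\<close>, which is why \<open>M0\<close> need only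
  dominate this number; \<open>M2\<close> then has to absorb \<open>M0\<close> times the slack of each sample.\<close>

lemma (in gauge) drcc_feasible_extends:
  fixes \<xi> :: "real ^ 'l ^ 'n" and X :: "(real ^ 'd) set" and M2 :: "real ^ 'n"
  assumes \<epsilon>: "0 < \<epsilon>" and X: "X \<subseteq> {x. \<forall>k. x $ k \<in> {0, 1}}" and A: "\<forall>x\<in>X. A_of Abar x \<noteq> 0"
    and \<alpha>bar: "\<alpha>bar < 1"
    and M0: "\<And>x. x \<in> X \<Longrightarrow> 1 / (\<epsilon> * dual_norm nrm (A_of Abar x)) \<le> M0"
    and M2: "\<And>x n. x \<in> X \<Longrightarrow> 1 + M0 * \<bar>A_of Abar x \<bullet> \<xi> $ n - b_of q bbar x\<bar> \<le> M2 $ n"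
    and feas: "(x, \<alpha>) \<in> drcc_feasible nrm X \<alpha>bar Abar bbar q \<xi> \<epsilon>"
  obtains \<pi> z \<beta> t where "(x, \<pi>, z, \<beta>, t, \<alpha>) \<in> mic_feasible nrm X \<alpha>bar Abar bbar q \<xi> \<epsilon> M0 M2"
proof -
  let ?a = "A_of Abar x"
  let ?D = "dual_norm nrm ?a"
  let ?r = "\<lambda>n. ?a \<bullet> \<xi> $ n - b_of q bbar x"
  from feas have x: "x \<in> X" and \<alpha>: "\<alpha> \<in> {0..\<alpha>bar}"
    by (auto simp: drcc_feasible_def)
  from x A have a: "?a \<noteq> 0" by blast
  then have D: "0 < ?D" by (rule dual_pos)
  define \<beta> :: "real \<Rightarrow> real ^ 'n" where "\<beta> t = (\<chi> n. max 0 (1 - t * max 0 (?r n)))" for t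
  from feas obtain t where t: "0 \<le> t"
    and budget: "\<epsilon> * real CARD('n) * dual_norm nrm (t *\<^sub>R ?a) + (\<Sum>n\<in>UNIV. \<beta> t $ n) \<le> \<alpha> * real CARD('n)"
    using worst_case_chance_scaled[OF a \<epsilon>, of \<alpha> "b_of q bbar x" \<xi>]
    by (auto simp: drcc_feasible_def \<beta>_def)
  have \<beta>_nonneg: "0 \<le> (\<Sum>n\<in>UNIV. \<beta> t $ n)"
    by (intro sum_nonneg) (simp add: \<beta>_def)
  have "\<epsilon> * real CARD('n) * (t * ?D) \<le> \<alpha> * real CARD('n)"
    using budget \<beta>_nonneg unfolding dual_scale[OF t] by linarith
  then have radius: "\<epsilon> * (t * ?D) \<le> \<alpha>"
    by (simp add: mult_ac)
  then have "t \<le> 1 / (\<epsilon> * ?D)"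
    using \<alpha> \<alpha>bar \<epsilon> D by (simp add: field_simps)
  with M0[OF x] have t_le: "t \<le> M0" by linarith
  \<comment> \<open>The level 0 is never attained: the adversary always has some budget to cause violations.\<close>
  have "0 < \<alpha>"
  proof (cases "t = 0")
    case True
    then have "real CARD('n) \<le> \<alpha> * real CARD('n)"
      using budget dual_scale[of 0 ?a] by (simp add: \<beta>_def)
    then show ?thesis by simp
  next
    case False
    then have "0 < \<epsilon> * (t * ?D)" using t D \<epsilon> by simp
    with radius show ?thesis by linarith
  qed
  define z :: "real ^ 'n" where "z = (\<chi> n. if 0 \<le> ?r n then 0 else 1)"
  have rows: "1 \<le> t * ?r n + z $ n * M2 $ n + \<beta> t $ n" "1 \<le> (1 - z $ n) * M2 $ n + \<beta> t $ n" for n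
    using big_M_rows_of_hinge[OF t t_le M2[OF x, of n]] by (simp_all add: z_def \<beta>_def)
  have signs: "z $ n = 0 \<or> z $ n = 1" "0 \<le> \<beta> t $ n" for n
    by (simp_all add: z_def \<beta>_def)
  have mccormick: "t + (x $ k - 1) * M0 \<le> (t *\<^sub>R x) $ k" "(t *\<^sub>R x) $ k \<le> x $ k * M0"
      "(t *\<^sub>R x) $ k \<le> t" "0 \<le> (t *\<^sub>R x) $ k" for k
  proof -
    have "x $ k = 0 \<or> x $ k = 1" using X x by auto
    then show "t + (x $ k - 1) * M0 \<le> (t *\<^sub>R x) $ k" "(t *\<^sub>R x) $ k \<le> x $ k * M0"
      "(t *\<^sub>R x) $ k \<le> t" "0 \<le> (t *\<^sub>R x) $ k"
      using t t_le by auto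
  qed
  have "(x, t *\<^sub>R x, z, \<beta> t, t, \<alpha>) \<in> mic_feasible nrm X \<alpha>bar Abar bbar q \<xi> \<epsilon> M0 M2"
    unfolding mic_feasible_def mem_Collect_eq case_prod_conv scaled_slack
    using x budget rows t mccormick \<alpha> \<open>0 < \<alpha>\<close> signs by (auto simp: A_of_scale)
  then show ?thesis by (rule that)
qed

text \<open>A sample with \<open>z $ n = 1\<close> has \<open>\<beta> $ n \<ge> 1\<close> by its second row, hence \<open>z \<le> \<beta>\<close> coordinatewise, and the budget row
  bounds the sum of \<open>\<beta>\<close>.\<close>

lemma (in gauge) mic_feasible_sum_z_le:
  fixes \<xi> :: "real ^ 'l ^ 'n"
  assumes \<epsilon>: "0 < \<epsilon>"
    and feas: "(x, \<pi>, z, \<beta>, t, \<alpha>) \<in> mic_feasible nrm X \<alpha>bar Abar bbar q \<xi> \<epsilon> M0 M2"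
  shows "(\<Sum>n\<in>UNIV. z $ n) \<le> \<alpha> * real CARD('n)"
proof -
  have "z $ n \<le> \<beta> $ n" for n
  proof -
    from feas have "z $ n = 0 \<or> z $ n = 1" "0 \<le> \<beta> $ n" "1 \<le> (1 - z $ n) * M2 $ n + \<beta> $ n"
      by (auto simp: mic_feasible_def)
    then show ?thesis by auto
  qed
  then have "(\<Sum>n\<in>UNIV. z $ n) \<le> (\<Sum>n\<in>UNIV. \<beta> $ n)"
    by (intro sum_mono)
  moreover have "0 \<le> \<epsilon> * real CARD('n) * dual_norm nrm (A_of Abar \<pi>)"
    using \<epsilon> by (simp add: dual_nonneg)
  ultimately show ?thesis
    using feas by (simp add: mic_feasible_def)
qed

theorem theorem4:
  fixes p :: ereal
    and X :: "(real ^ 'd) set"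
    and c bbar :: "real ^ 'd"
    and \<alpha>bar q \<epsilon> :: real
    and g :: "real \<Rightarrow> real"
    and Abar :: "real ^ 'd ^ 'l"
    and \<xi> :: "real ^ 'l ^ 'n"
  assumes "1 \<le> p"
    and "0 < \<alpha>bar" "\<alpha>bar < 1"
    and "mono_on {0..\<alpha>bar} g" "\<forall>\<alpha>\<in>{0..\<alpha>bar}. 0 \<le> g \<alpha>"
    and "0 < \<epsilon>"
    and "X \<subseteq> {x. \<forall>k. x $ k \<in> {0, 1}}"
    and "\<forall>x\<in>X. A_of Abar x \<noteq> 0"
  shows "\<exists>M0_min. \<forall>M0\<ge>M0_min. \<exists>M2_min :: real ^ 'n. \<forall>M2. (\<forall>n. M2 $ n \<ge> M2_min $ n) \<longrightarrow>
    equivalent_formulation mic_proj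
      (drcc_feasible (pnorm p) X \<alpha>bar Abar bbar q \<xi> \<epsilon>) (drcc_objective c g)
      (mic_feasible (pnorm p) X \<alpha>bar Abar bbar q \<xi> \<epsilon> M0 M2) (mic_objective c g) \<and>
    (\<forall>(x, \<pi>, z, \<beta>, t, \<alpha>)\<in>mic_feasible (pnorm p) X \<alpha>bar Abar bbar q \<xi> \<epsilon> M0 M2.
      (\<Sum>n\<in>UNIV. z $ n) \<le> \<alpha> * real CARD('n))"
proof -
  interpret gauge "pnorm p :: real ^ 'l \<Rightarrow> real"
    using assms(1) by (rule gauge_pnorm)
  note \<epsilon> = \<open>0 < \<epsilon>\<close> and X = \<open>X \<subseteq> {x. \<forall>k. x $ k \<in> {0, 1}}\<close>
    and A = \<open>\<forall>x\<in>X. A_of Abar x \<noteq> 0\<close>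
  have fin: "finite X"
    using X finite_binary_vectors by (rule finite_subset)
  let ?T = "\<lambda>x. 1 / (\<epsilon> * dual_norm (pnorm p) (A_of Abar x))"
  let ?s = "\<lambda>x n. \<bar>A_of Abar x \<bullet> \<xi> $ n - b_of q bbar x\<bar>"
  \<comment> \<open>Sums over the finite set of decisions are convenient upper bounds for the maxima required.\<close>
  show ?thesis
  proof (rule exI[of _ "\<Sum>x\<in>X. ?T x"], intro allI impI)
    fix M0 :: real
    assume M0: "(\<Sum>x\<in>X. ?T x) \<le> M0"
    have T_nonneg: "0 \<le> ?T x" for x
      using \<epsilon> by (simp add: dual_nonneg)
    have M0_nonneg: "0 \<le> M0"
      using M0 sum_nonneg[of X ?T] T_nonneg by force
    have T_le: "?T x \<le> M0" if "x \<in> X" for x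
      using member_le_sum[OF that _ fin, of ?T] T_nonneg M0 by force
    show "\<exists>M2_min :: real ^ 'n. \<forall>M2. (\<forall>n. M2 $ n \<ge> M2_min $ n) \<longrightarrow>
      equivalent_formulation mic_proj
        (drcc_feasible (pnorm p) X \<alpha>bar Abar bbar q \<xi> \<epsilon>) (drcc_objective c g)
        (mic_feasible (pnorm p) X \<alpha>bar Abar bbar q \<xi> \<epsilon> M0 M2) (mic_objective c g) \<and>
      (\<forall>(x, \<pi>, z, \<beta>, t, \<alpha>)\<in>mic_feasible (pnorm p) X \<alpha>bar Abar bbar q \<xi> \<epsilon> M0 M2.
        (\<Sum>n\<in>UNIV. z $ n) \<le> \<alpha> * real CARD('n))"
    proof (rule exI[of _ "\<chi> n. 1 + M0 * (\<Sum>x\<in>X. ?s x n)"], intro allI impI)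
      fix M2 :: "real ^ 'n"
      assume M2: "\<forall>n. M2 $ n \<ge> (\<chi> n. 1 + M0 * (\<Sum>x\<in>X. ?s x n)) $ n"
      have s_le: "1 + M0 * ?s x n \<le> M2 $ n" if "x \<in> X" for x n
      proof -
        have "?s x n \<le> (\<Sum>x\<in>X. ?s x n)"
          using member_le_sum[OF that _ fin, of "\<lambda>x. ?s x n"] by force
        then have "M0 * ?s x n \<le> M0 * (\<Sum>x\<in>X. ?s x n)"
          using M0_nonneg by (rule mult_left_mono)
        with M2[rule_format, of n] show ?thesis by simp
      qed
      let ?F = "drcc_feasible (pnorm p) X \<alpha>bar Abar bbar q \<xi> \<epsilon>"
      let ?G = "mic_feasible (pnorm p) X \<alpha>bar Abar bbar q \<xi> \<epsilon> M0 M2"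
      have "u \<in> ?F \<longleftrightarrow> (\<exists>v\<in>?G. mic_proj v = u)" for u
      proof
        assume "u \<in> ?F"
        moreover obtain x \<alpha> where u: "u = (x, \<alpha>)" by (cases u)
        ultimately obtain \<pi> z \<beta> t where "(x, \<pi>, z, \<beta>, t, \<alpha>) \<in> ?G"
          using drcc_feasible_extends[OF \<epsilon> X A \<open>\<alpha>bar < 1\<close> T_le s_le] by metis
        then show "\<exists>v\<in>?G. mic_proj v = u"
          by (rule bexI[rotated]) (simp add: mic_proj_def u)
      next
        assume "\<exists>v\<in>?G. mic_proj v = u"
        then show "u \<in> ?F"
          using mic_feasible_imp_drcc_feasible[OF \<epsilon> X A] by (auto simp: mic_proj_def)
      qed
      moreover have "mic_objective c g v = drcc_objective c g (mic_proj v)" for v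
        by (simp add: mic_objective_def drcc_objective_def mic_proj_def split: prod.split)
      ultimately show "equivalent_formulation mic_proj ?F (drcc_objective c g) ?G (mic_objective c g) \<and>
        (\<forall>(x, \<pi>, z, \<beta>, t, \<alpha>)\<in>?G. (\<Sum>n\<in>UNIV. z $ n) \<le> \<alpha> * real CARD('n))"
        using mic_feasible_sum_z_le[OF \<epsilon>] unfolding equivalent_formulation_def by blast
    qed
  qed
qed

end
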